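(* Let $k\ge 0$ and let $\pi$ be a set of $q$ pairwise disjoint two-element subsets of $\{1,\dots,k\}$; let $m=k-2q$ and let $i_1<\dots<i_m$ be the indices not belonging to any pair of $\pi$. For $n\ge 2$ let $F_{\pi,n}(x_{i_1},\dots,x_{i_m})$ be the $m$-linear form on $so(n)$ obtained from the $k$-linear form $f(x_1,\dots,x_k)=\mathrm{Tr}(\mathrm{ad}_{x_1}\cdots \mathrm{ad}_{x_k})$ by contracting along all pairs of $\pi$. Then there are finitely many expressions $T$, each a product of traces of products of the matrices $x_{i_j}$ and $x_{i_j}^{*}$, and polynomials $p_T$ in one variable (depending only on $k$ and $\pi$, not on $n$) such that $F_{\pi,n}(x_{i_1},\dots,x_{i_m})=\sum_T p_T(n)\,T(x_{i_1},\dots,x_{i_m})$ for all $n\ge 2$ and all $x_{i_1},\dots,x_{i_m}\in so(n)$.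
   Context: Work over a field of characteristic $0$. $so(n)$ is the Lie algebra of skew-symmetric $n\times n$ matrices, $\mathrm{ad}_x(u)=[x,u]=xu-ux$ on $so(n)$, and $\mathrm{Tr}(\mathrm{ad}_{x_1}\cdots\mathrm{ad}_{x_k})$ is the trace of a linear operator on $so(n)$ (for $k=0$ the trace of the identity operator). In the expressions $T$, traces are ordinary traces of $n\times n$ matrices, $x^{*}$ is the transpose of $x$, and the empty product of traces is $1$. Contracting along a pair $\{a,b\}$ means replacing the form by $\sum_{\alpha} f(\dots,\alpha,\dots,\tilde\alpha,\dots)$, where the arguments $x_a,x_b$ are replaced by $\alpha,\tilde\alpha$, $\alpha$ runs over a basis of $so(n)$ and $\tilde\alpha$ over the corresponding dual basis with respect to the form $\langle X,Y\rangle=\mathrm{Tr}(XY)$ (trace of the $n\times n$ matrix). Contracting along $\pi$ means doing this for every pair of $\pi$. The result does not depend on the choice of basis. *)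

theory Defs
  imports
    "Jordan_Normal_Form.VS_Connect"
    "HOL-Computational_Algebra.Polynomial"
    "HOL-Library.FuncSet"
begin

section \<open>The Lie algebra \<open>so(n)\<close>\<close>

definition so :: "nat \<Rightarrow> 'a :: field mat set" where
  "so n = {A \<in> carrier_mat n n. transpose_mat A = - A}"

definition so_space :: "nat \<Rightarrow> ('a :: field, 'a mat) module" where
  "so_space n = (module_mat TYPE('a) n n)\<lparr>carrier := so n\<rparr>"

definition ad :: "'a :: field mat \<Rightarrow> 'a mat \<Rightarrow> 'a mat" where
  "ad x u = x * u - u * x"

definition mat_trace :: "'a :: comm_monoid_add mat \<Rightarrow> 'a" where
  "mat_trace A = (\<Sum>i<dim_row A. A $$ (i, i))"

section \<open>Trace of a linear operator\<close>

definition coords :: "('a :: field, 'v) module \<Rightarrow> 'v set \<Rightarrow> 'v \<Rightarrow> 'v \<Rightarrow> 'a" where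
  "coords V B v =
     (THE c. c \<in> extensional B \<and> LinearCombinations.module.lincomb V c B = v)"

text \<open>The sum of the diagonal entries of the matrix of \<open>L\<close> with respect to a chosen finite
  basis of \<open>V\<close>.\<close>

definition operator_trace :: "('a :: field, 'v) module \<Rightarrow> ('v \<Rightarrow> 'v) \<Rightarrow> 'a" where
  "operator_trace V L =
     (let B = (SOME B. finite B \<and> vectorspace.basis class_ring V B)
      in \<Sum>b\<in>B. coords V B (L b) b)"

definition ad_trace :: "nat \<Rightarrow> nat \<Rightarrow> (nat \<Rightarrow> 'a :: field mat) \<Rightarrow> 'a" where
  "ad_trace n k x = operator_trace (so_space n) (foldr (\<lambda>i. ad (x i)) [1..<Suc k])"

section \<open>Contraction\<close>

text \<open>\<open>B\<close> is a basis of \<open>so(n)\<close> and \<open>d b\<close>, for \<open>b \<in> B\<close>, is the member of the dual basis that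
  corresponds to \<open>b\<close>.\<close>

definition so_dual_bases :: "nat \<Rightarrow> 'a :: field mat set \<Rightarrow> ('a mat \<Rightarrow> 'a mat) \<Rightarrow> bool" where
  "so_dual_bases n B d \<longleftrightarrow>
     finite B \<and> vectorspace.basis class_ring (so_space n) B \<and> d \<in> B \<rightarrow> so n \<and>
     (\<forall>a\<in>B. \<forall>b\<in>B. mat_trace (a * d b) = (if a = b then 1 else 0))"

definition free_indices :: "nat \<Rightarrow> nat set set \<Rightarrow> nat set" where
  "free_indices k \<pi> = {1..k} - \<Union>\<pi>"

text \<open>A pair \<open>P = {a, b}\<close> with \<open>a < b\<close> carries the basis element \<open>\<phi> P\<close> in argument \<open>a\<close> and its
  dual in argument \<open>b\<close>; all other arguments are those of \<open>x\<close>.\<close>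

definition plug ::
  "nat set set \<Rightarrow> ('v \<Rightarrow> 'v) \<Rightarrow> (nat set \<Rightarrow> 'v) \<Rightarrow> (nat \<Rightarrow> 'v) \<Rightarrow> nat \<Rightarrow> 'v" where
  "plug \<pi> d \<phi> x i =
     (if i \<in> \<Union>\<pi> then
        let P = (THE P. P \<in> \<pi> \<and> i \<in> P) in if i = Min P then \<phi> P else d (\<phi> P)
      else x i)"

text \<open>All pairs are contracted simultaneously: \<open>\<phi>\<close> runs over all choices of one basis element
  for each pair.\<close>

definition contract ::
  "'v set \<Rightarrow> ('v \<Rightarrow> 'v) \<Rightarrow> nat set set \<Rightarrow> ((nat \<Rightarrow> 'v) \<Rightarrow> 'a :: comm_monoid_add) \<Rightarrow>
     (nat \<Rightarrow> 'v) \<Rightarrow> 'a" where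
  "contract B d \<pi> f x = (\<Sum>\<phi>\<in>\<pi> \<rightarrow>\<^sub>E B. f (plug \<pi> d \<phi> x))"

section \<open>Products of traces of words in the matrices and their transposes\<close>

datatype letter = Plain (index: nat) | Transposed (index: nat)

fun letter_mat :: "(nat \<Rightarrow> 'a mat) \<Rightarrow> letter \<Rightarrow> 'a mat" where
  "letter_mat x (Plain i) = x i"
| "letter_mat x (Transposed i) = transpose_mat (x i)"

text \<open>A word stands for a product of matrices, a list of words for the product of their traces.\<close>

type_synonym word = "letter list"
type_synonym trace_expr = "word list"

definition word_mat :: "nat \<Rightarrow> (nat \<Rightarrow> 'a :: field mat) \<Rightarrow> word \<Rightarrow> 'a mat" where
  "word_mat n x w = foldr (\<lambda>l A. letter_mat x l * A) w (1\<^sub>m n)"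

definition expr_value :: "nat \<Rightarrow> (nat \<Rightarrow> 'a :: field mat) \<Rightarrow> trace_expr \<Rightarrow> 'a" where
  "expr_value n x T = (\<Prod>w\<leftarrow>T. mat_trace (word_mat n x w))"

definition trace_exprs_over :: "nat set \<Rightarrow> trace_expr set" where
  "trace_exprs_over I = {T. \<forall>w\<in>set T. w \<noteq> [] \<and> index ` set w \<subseteq> I}"

section \<open>Dual bases of \<open>so(n)\<close> exist\<close>

lemma vectorspace_so_space:
  "vectorspace (class_ring :: 'a :: field ring) (so_space n :: ('a, 'a mat) module)"
proof -
  interpret V: vectorspace "class_ring :: 'a ring" "module_mat TYPE('a) n n"
    by (rule matrix_vs)
  have "submodule class_ring (so n :: 'a mat set) (module_mat TYPE('a) n n)"
  proof
    fix A B :: "'a mat" assume A: "A \<in> so n" and B: "B \<in> so n"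
    then have c: "A \<in> carrier_mat n n" "B \<in> carrier_mat n n"
      and t: "transpose_mat A = - A" "transpose_mat B = - B" by (auto simp: so_def)
    have "transpose_mat (A + B) = - A + - B" using transpose_add[OF c] t by simp
    also have "\<dots> = - (A + B)" using c by auto
    finally show "A \<oplus>\<^bsub>module_mat TYPE('a) n n\<^esub> B \<in> so n" using c by (auto simp: so_def module_mat_simps)
  next
    fix c :: 'a and A :: "'a mat" assume "A \<in> so n"
    then have c: "A \<in> carrier_mat n n" and t: "transpose_mat A = - A" by (auto simp: so_def)
    have "transpose_mat (c \<cdot>\<^sub>m A) = c \<cdot>\<^sub>m transpose_mat A" by (rule eq_matI) auto
    also have "\<dots> = - (c \<cdot>\<^sub>m A)" unfolding t by (rule eq_matI) auto
    finally show "c \<odot>\<^bsub>module_mat TYPE('a) n n\<^esub> A \<in> so n" using c by (auto simp: so_def module_mat_simps)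
  qed (auto simp: so_def module_mat_simps V.module_axioms)
  then have "VectorSpace.subspace class_ring (so n :: 'a mat set) (module_mat TYPE('a) n n)"
    using V.vectorspace_axioms unfolding VectorSpace.subspace_def by blast
  from V.subspace_is_vs[OF this] show ?thesis by (simp add: so_space_def)
qed

lemma lincomb_so_space:
  assumes "finite A" "A \<subseteq> (so n :: 'a :: field mat set)"
  shows "LinearCombinations.module.lincomb (so_space n) a A \<in> so n \<and>
    (\<forall>r<n. \<forall>s<n. LinearCombinations.module.lincomb (so_space n) a A $$ (r, s) = (\<Sum>b\<in>A. a b * b $$ (r, s)))"
proof -
  interpret V: vectorspace "class_ring :: 'a ring" "so_space n :: ('a, 'a mat) module"
    by (rule vectorspace_so_space)
  have car: "carrier (so_space n :: ('a, 'a mat) module) = so n" by (simp add: so_space_def)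
  have sm: "c \<odot>\<^bsub>so_space n\<^esub> v \<in> so n" if "v \<in> so n" for c and v :: "'a mat"
    using V.smult_closed[of c v] that by (simp add: car)
  show ?thesis
    using assms
  proof (induction rule: finite_induct)
    case empty
    have "V.lincomb a {} = 0\<^sub>m n n" by (simp add: V.lincomb_def) (simp add: so_space_def module_mat_simps)
    moreover have "0\<^sub>m n n \<in> (so n :: 'a mat set)" using V.M.zero_closed
      by (simp add: so_space_def module_mat_simps)
    ultimately show ?case by auto
  next
    case (insert x F)
    have eq: "V.lincomb a (insert x F) = a x \<odot>\<^bsub>so_space n\<^esub> x \<oplus>\<^bsub>so_space n\<^esub> V.lincomb a F"
      using insert unfolding V.lincomb_def
      by (subst V.M.finsum_insert) (auto simp: car intro!: sm)
    have cl: "a x \<odot>\<^bsub>so_space n\<^esub> x \<in> so n" using insert sm by auto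
    have cl2: "V.lincomb a (insert x F) \<in> so n" unfolding eq using V.M.a_closed cl insert by (auto simp: car)
    have x: "x \<in> carrier_mat n n" and "V.lincomb a F \<in> carrier_mat n n" using insert by (auto simp: so_def)
    then have "V.lincomb a (insert x F) $$ (r, s) = a x * x $$ (r, s) + V.lincomb a F $$ (r, s)"
      if "r < n" "s < n" for r s
      unfolding eq using that by (auto simp: so_space_def module_mat_simps)
    then show ?case using insert cl2 by auto
  qed
qed

lemma mat_trace_mult:
  assumes "A \<in> carrier_mat n n" "B \<in> carrier_mat n n"
  shows "mat_trace (A * B) = (\<Sum>r<n. \<Sum>s<n. A $$ (r, s) * B $$ (s, r))"
  using assms by (simp add: mat_trace_def scalar_prod_def atLeast0LessThan)

lemma so_dual_bases_exist:
  "\<exists>B d. so_dual_bases n B (d :: 'a :: field_char_0 mat \<Rightarrow> 'a mat)"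
proof -
  interpret V: vectorspace "class_ring :: 'a ring" "so_space n :: ('a, 'a mat) module"
    by (rule vectorspace_so_space)
  have car: "carrier (so_space n :: ('a, 'a mat) module) = so n" by (simp add: so_space_def)
  define f :: "nat \<times> nat \<Rightarrow> 'a mat" where
    "f = (\<lambda>p. mat n n (\<lambda>q. if q = p then 1 else if q = (snd p, fst p) then - 1 else 0))"
  define P where "P = {(i, j). i < j \<and> j < n}"
  have finP: "finite P" by (rule finite_subset[of _ "{..<n} \<times> {..<n}"]) (auto simp: P_def)
  have val: "f p $$ q = (if q = p then 1 else 0)" if "p \<in> P" "q \<in> P" for p q
    using that by (auto simp: f_def P_def split: if_splits)
  have inj: "inj_on f P"
    by (rule inj_onI) (metis val one_neq_zero)
  have fso: "f p \<in> so n" if "p \<in> P" for p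
    using that by (auto simp: so_def f_def P_def transpose_mat_def  intro!: eq_matI)
  have B: "f ` P \<subseteq> so n" using fso by auto
  have li: "\<not> V.lin_dep (f ` P)"
  proof
    assume "V.lin_dep (f ` P)"
    then obtain A a v where A: "finite A" "A \<subseteq> f ` P" "v \<in> A" "a v \<noteq> 0"
      and l: "V.lincomb a A = \<zero>\<^bsub>so_space n\<^esub>" unfolding V.lin_dep_def by auto
    obtain p where p: "p \<in> P" "v = f p" using A by auto
    have lt: "fst p < n" "snd p < n" using p by (auto simp: P_def)
    have "0 = V.lincomb a A $$ p"
      unfolding l using lt by (cases p) (auto simp: so_space_def module_mat_simps)
    also have "\<dots> = (\<Sum>b\<in>A. a b * b $$ p)"
      using lincomb_so_space[of A n a] A B lt by (cases p) auto
    also have "\<dots> = (\<Sum>b\<in>A. if b = v then a v else 0)"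
    proof (rule sum.cong[OF refl])
      fix b assume "b \<in> A"
      then obtain q where q: "q \<in> P" "b = f q" using A by auto
      show "a b * b $$ p = (if b = v then a v else 0)"
        using val[OF q(1) p(1)] inj_on_eq_iff[OF inj q(1) p(1)] q p by auto
    qed
    also have "\<dots> = a v" using A by simp
    finally show False using A by simp
  qed
  have gen: "V.span (f ` P) = so n"
  proof
    show "V.span (f ` P) \<subseteq> so n" using V.span_is_subset2[of "f ` P"] B by (simp add: car)
    show "so n \<subseteq> V.span (f ` P)"
    proof
      fix A :: "'a mat" assume A: "A \<in> so n"
      then have Ac: "A \<in> carrier_mat n n" and At: "transpose_mat A = - A" by (auto simp: so_def)
      have sk: "A $$ (s, r) = - A $$ (r, s)" if "r < n" "s < n" for r s
      proof -
        have "transpose_mat A $$ (r, s) = (- A) $$ (r, s)" using At by simp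
        then show ?thesis using that Ac by auto
      qed
      define c where "c = (\<lambda>b. A $$ inv_into P f b)"
      have L: "V.lincomb c (f ` P) \<in> carrier_mat n n"
        using lincomb_so_space[OF _ B, of c] finP by (auto simp: so_def)
      have "V.lincomb c (f ` P) = A"
      proof (rule eq_matI)
        fix r s assume "r < dim_row A" "s < dim_col A"
        then have rs: "r < n" "s < n" using Ac by auto
        have "V.lincomb c (f ` P) $$ (r, s) = (\<Sum>b\<in>f ` P. c b * b $$ (r, s))"
          using lincomb_so_space[OF _ B, of c] finP rs by auto
        also have "\<dots> = (\<Sum>p\<in>P. A $$ p * f p $$ (r, s))"
          using inj by (subst sum.reindex) (auto simp: c_def)
        also have "\<dots> = A $$ (r, s)"
        proof (cases r s rule: linorder_cases)
          case less
          have "(\<Sum>p\<in>P. A $$ p * f p $$ (r, s)) = (\<Sum>p\<in>P. if p = (r, s) then A $$ (r, s) else 0)"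
            using rs less val[of _ "(r, s)"] by (intro sum.cong) (auto simp: P_def)
          also have "\<dots> = A $$ (r, s)" using finP less rs by (simp add: P_def)
          finally show ?thesis .
        next
          case equal
          have "A $$ (r, r) = - A $$ (r, r)" using sk rs by blast
          then have "A $$ (r, r) + A $$ (r, r) = 0" by (rule iffD1[OF eq_neg_iff_add_eq_0])
          then have "2 * A $$ (r, r) = 0" by (simp only: mult_2)
          then have "A $$ (r, r) = 0" by simp
          moreover have "(\<Sum>p\<in>P. A $$ p * f p $$ (r, s)) = 0"
            using equal rs by (intro sum.neutral) (auto simp: P_def f_def)
          ultimately show ?thesis using equal by simp
        next
          case greater
          have "(\<Sum>p\<in>P. A $$ p * f p $$ (r, s)) = (\<Sum>p\<in>P. if p = (s, r) then - A $$ (s, r) else 0)"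
            using rs greater by (intro sum.cong) (auto simp: P_def f_def)
          also have "\<dots> = - A $$ (s, r)" using finP greater rs by (simp add: P_def)
          finally show ?thesis by (simp only: sk[OF rs] minus_minus)
        qed
        finally show "V.lincomb c (f ` P) $$ (r, s) = A $$ (r, s)" .
      qed (use L Ac in auto)
      then show "A \<in> V.span (f ` P)" unfolding V.span_def using finP by force
    qed
  qed
  have basis: "V.basis (f ` P)" unfolding V.basis_def using li gen B by (simp add: car)
  define d :: "'a mat \<Rightarrow> 'a mat" where "d = (\<lambda>b. (- (1 / 2)) \<cdot>\<^sub>m b)"
  have dso: "d \<in> f ` P \<rightarrow> so n"
    using V.smult_closed[of "- (1 / 2)"] B by (auto simp: d_def so_space_def module_mat_simps)
  have tr: "mat_trace (f p * d (f q)) = (if f p = f q then 1 else 0)" if p: "p \<in> P" and q: "q \<in> P" for p q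
  proof -
    obtain i j where ij: "p = (i, j)" "i < j" "j < n" using p by (auto simp: P_def)
    have qlt: "fst q < snd q" "snd q < n" using q by (auto simp: P_def)
    have "mat_trace (f p * d (f q)) = (\<Sum>r<n. \<Sum>s<n. f p $$ (r, s) * d (f q) $$ (s, r))"
      by (rule mat_trace_mult) (simp_all add: f_def d_def)
    also have "\<dots> = (\<Sum>r<n. \<Sum>s<n. (if r = i then if s = j then d (f q) $$ (j, i) else 0 else 0)
        - (if r = j then if s = i then d (f q) $$ (i, j) else 0 else 0))"
      using ij by (intro sum.cong) (auto simp: f_def)
    also have "\<dots> = (\<Sum>r<n. (if r = i then d (f q) $$ (j, i) else 0) - (if r = j then d (f q) $$ (i, j) else 0))"
      using ij by (intro sum.cong) (auto simp: sum_subtractf)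
    also have "\<dots> = d (f q) $$ (j, i) - d (f q) $$ (i, j)" using ij by (simp add: sum_subtractf)
    also have "\<dots> = (if p = q then 1 else 0)"
      using ij qlt by (cases q) (auto simp: d_def f_def)
    finally show ?thesis using inj_on_eq_iff[OF inj p q] by simp
  qed
  show ?thesis
    unfolding so_dual_bases_def using finP basis dso tr
    by (intro exI[of _ "f ` P"] exI[of _ d]) auto
qed

end

theory Submission
  imports Defs
begin

text \<open>Everything rests on the completeness relation (\<open>dual_bases_completeness\<close>)
  \<open>\<Sum>b. b\<^bsub>rs\<^esub> (d b)\<^bsub>tu\<^esub> = (\<delta>\<^bsub>ru\<^esub> \<delta>\<^bsub>st\<^esub> - \<delta>\<^bsub>rt\<^esub> \<delta>\<^bsub>su\<^esub>) / 2\<close>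
  for dual bases of \<open>so(n)\<close>. It gives the two rules
  \<open>\<Sum>b. Tr(A b C (d b)) = (Tr(A) Tr(C) - Tr(A C\<^sup>T)) / 2\<close> and
  \<open>\<Sum>b. Tr(A b) Tr(C (d b)) = (Tr(A C) - Tr(A C\<^sup>T)) / 2\<close>
  (\<open>contract_one_trace\<close>, \<open>contract_two_traces\<close>), which do not refer to the basis and in which \<open>n\<close>
  does not occur.

  The trace of an operator \<open>L\<close> on \<open>so(n)\<close> is \<open>\<Sum>b. Tr(L(b) (d b))\<close> (\<open>operator_trace_so\<close>). For a
  product \<open>L\<close> of adjoint operators, \<open>L(b)\<close> expands into a signed sum of terms \<open>U b V\<close> with words
  \<open>U\<close> and \<open>V\<close> in the \<open>x\<^sub>i\<close>, so that the first rule expresses \<open>f\<close> through products of traces of words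
  in which every index occurs exactly once (\<open>trace_form_ad_trace\<close>). Contracting a pair in such a
  product is one of the two rules, according to whether the two indices stand in the same trace or
  in different ones, and yields products of the same kind in the other indices
  (\<open>contract_monomial\<close>). Induction over the pairs finishes the argument
  (\<open>contract_trace_form\<close>).

  The dimension enters only as the trace of an empty word, which is \<open>n\<close>; collecting these factors
  gives the polynomial coefficients (\<open>trace_form_expressions\<close>). Transposes never have to be kept:
  on skew-symmetric matrices the transpose of a word is, up to sign, the reversed word.\<close>

section \<open>Skew-symmetric matrices and traces\<close>

lemma so_carrier: "A \<in> so n \<Longrightarrow> A \<in> carrier_mat n n"
  by (simp add: so_def)

lemma so_transpose: "A \<in> so n \<Longrightarrow> transpose_mat A = - A"
  by (simp add: so_def)

lemma so_skew:
  assumes "A \<in> so n" "r < n" "s < n"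
  shows "A $$ (s, r) = - A $$ (r, s)"
proof -
  have "transpose_mat A $$ (r, s) = (- A) $$ (r, s)"
    using so_transpose[OF assms(1)] by simp
  then show ?thesis using so_carrier[OF assms(1)] assms(2,3) by auto
qed

lemma soI:
  assumes "A \<in> carrier_mat n n" "\<And>r s. r < n \<Longrightarrow> s < n \<Longrightarrow> A $$ (s, r) = - A $$ (r, s)"
  shows "A \<in> so n"
proof -
  have "transpose_mat A = - A"
  proof (rule eq_matI)
    fix s r assume "s < dim_row (- A)" "r < dim_col (- A)"
    then have "s < n" "r < n" using assms(1) by auto
    then show "transpose_mat A $$ (s, r) = (- A) $$ (s, r)"
      using assms(1) assms(2)[of s r] by auto
  qed (use assms(1) in auto)
  then show ?thesis using assms(1) by (simp add: so_def)
qed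

lemma so_ad:
  assumes "x \<in> so n" "u \<in> so n"
  shows "ad x u \<in> so n"
proof -
  have c: "x \<in> carrier_mat n n" "u \<in> carrier_mat n n" using assms by (auto dest: so_carrier)
  have s: "(x * u) $$ (q, r) = (u * x) $$ (r, q)" if "r < n" "q < n" for r q
  proof -
    have "(\<Sum>i = 0..<n. x $$ (q, i) * u $$ (i, r)) = (\<Sum>i = 0..<n. u $$ (r, i) * x $$ (i, q))"
      using that by (intro sum.cong) (auto simp: so_skew[OF assms(1), of q] so_skew[OF assms(2), of _ r])
    then show ?thesis using c that by (simp add: scalar_prod_def)
  qed
  show ?thesis
    by (rule soI) (use c s in \<open>auto simp: ad_def\<close>)
qed

lemma mat_trace_comm:
  fixes A B :: "'a :: field mat"
  assumes "A \<in> carrier_mat n n" "B \<in> carrier_mat n n"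
  shows "mat_trace (A * B) = mat_trace (B * A)"
  unfolding mat_trace_mult[OF assms] mat_trace_mult[OF assms(2,1)]
  by (subst sum.swap) (simp add: mult.commute)

lemma mat_trace_smult:
  "A \<in> carrier_mat n n \<Longrightarrow> mat_trace (c \<cdot>\<^sub>m A) = (c :: 'a :: field) * mat_trace A"
  by (simp add: mat_trace_def sum_distrib_left)

lemma mat_trace_diff:
  "A \<in> carrier_mat n n \<Longrightarrow> B \<in> carrier_mat n n \<Longrightarrow>
    mat_trace (A - B :: 'a :: field mat) = mat_trace A - mat_trace B"
  by (simp add: mat_trace_def sum_subtractf)

section \<open>Coordinates in \<open>so(n)\<close>\<close>

abbreviation so_basis :: "nat \<Rightarrow> 'a :: field mat set \<Rightarrow> bool" where
  "so_basis n B \<equiv> finite B \<and> vectorspace.basis class_ring (so_space n) B"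

lemma so_basis_subset: "so_basis n B \<Longrightarrow> B \<subseteq> so n"
  using vectorspace.basis_def[OF vectorspace_so_space, of n B] by (simp add: so_space_def)

lemma so_basis_coeffs:
  fixes X :: "'a :: field mat"
  assumes "so_basis n B" "X \<in> so n"
  shows "\<exists>!c. c \<in> extensional B \<and> LinearCombinations.module.lincomb (so_space n) c B = X"
proof -
  interpret V: vectorspace "class_ring :: 'a ring" "so_space n :: ('a, 'a mat) module"
    by (rule vectorspace_so_space)
  have car: "carrier (so_space n :: ('a, 'a mat) module) = so n" by (simp add: so_space_def)
  have "\<exists>!c. c \<in> B \<rightarrow>\<^sub>E carrier (class_ring :: 'a ring) \<and> V.lincomb c B = X"
    using V.basis_criterion[of B] assms so_basis_subset[OF assms(1)] by (auto simp: car)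
  then show ?thesis by (simp add: PiE_def)
qed

text \<open>Entrywise equations are used throughout in place of linear combinations in the module
  \<open>so_space n\<close>: they turn every later identity into a rearrangement of finite sums.\<close>

lemma coords_so:
  fixes X :: "'a :: field mat"
  assumes "so_basis n B" "X \<in> so n" "r < n" "s < n"
  shows "X $$ (r, s) = (\<Sum>b\<in>B. coords (so_space n) B X b * b $$ (r, s))"
proof -
  have "LinearCombinations.module.lincomb (so_space n) (coords (so_space n) B X) B = X"
    using theI'[OF so_basis_coeffs[OF assms(1,2)]] unfolding coords_def by blast
  then show ?thesis
    using lincomb_so_space[of B n "coords (so_space n) B X"] so_basis_subset[OF assms(1)] assms by auto
qed

lemma coords_so_unique:
  fixes X :: "'a :: field mat"
  assumes "so_basis n B" "X \<in> so n" "b \<in> B"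
    and eq: "\<And>r s. r < n \<Longrightarrow> s < n \<Longrightarrow> X $$ (r, s) = (\<Sum>b\<in>B. c b * b $$ (r, s))"
  shows "coords (so_space n) B X b = c b"
proof -
  let ?c = "restrict c B"
  have L: "LinearCombinations.module.lincomb (so_space n) ?c B \<in> so n \<and>
    (\<forall>r<n. \<forall>s<n. LinearCombinations.module.lincomb (so_space n) ?c B $$ (r, s) = (\<Sum>b\<in>B. ?c b * b $$ (r, s)))"
    using lincomb_so_space[where A = B and n = n and a = ?c] so_basis_subset[OF assms(1)] assms(1) by blast
  have "LinearCombinations.module.lincomb (so_space n) ?c B = X"
    using L so_carrier[OF assms(2)] so_carrier[OF L[THEN conjunct1]] eq
    by (intro eq_matI) auto
  then have "coords (so_space n) B X = ?c"
    unfolding coords_def by (intro the1_equality[OF so_basis_coeffs[OF assms(1,2)]]) simp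
  then show ?thesis using assms(3) by simp
qed

text \<open>Pairing the expansion of \<open>X\<close> with \<open>d b\<close> kills all terms but the one at \<open>b\<close>.\<close>

lemma coords_eq_trace_dual:
  fixes X :: "'a :: field mat"
  assumes D: "so_dual_bases n B d" and X: "X \<in> so n" and b: "b \<in> B"
  shows "coords (so_space n) B X b = mat_trace (X * d b)"
proof -
  have bas: "so_basis n B" using D by (simp add: so_dual_bases_def)
  have db: "d b \<in> so n" using D b by (auto simp: so_dual_bases_def)
  let ?c = "coords (so_space n) B X"
  have "mat_trace (X * d b) = (\<Sum>r<n. \<Sum>s<n. X $$ (r, s) * d b $$ (s, r))"
    by (intro mat_trace_mult so_carrier X db)
  also have "\<dots> = (\<Sum>r<n. \<Sum>s<n. \<Sum>a\<in>B. ?c a * (a $$ (r, s) * d b $$ (s, r)))"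
    by (intro sum.cong refl) (simp add: coords_so[OF bas X] sum_distrib_right mult.assoc)
  also have "\<dots> = (\<Sum>r<n. \<Sum>a\<in>B. \<Sum>s<n. ?c a * (a $$ (r, s) * d b $$ (s, r)))"
    by (intro sum.cong refl sum.swap)
  also have "\<dots> = (\<Sum>a\<in>B. \<Sum>r<n. \<Sum>s<n. ?c a * (a $$ (r, s) * d b $$ (s, r)))"
    by (rule sum.swap)
  also have "\<dots> = (\<Sum>a\<in>B. ?c a * mat_trace (a * d b))"
    using so_basis_subset[OF bas] db
    by (intro sum.cong refl) (auto simp: mat_trace_mult[of _ n] so_carrier sum_distrib_left)
  also have "\<dots> = (\<Sum>a\<in>B. if a = b then ?c a else 0)"
    using D b by (intro sum.cong refl) (auto simp: so_dual_bases_def)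
  also have "\<dots> = ?c b" using bas b by simp
  finally show ?thesis by simp
qed

lemma dual_bases_expansion:
  fixes X :: "'a :: field mat"
  assumes D: "so_dual_bases n B d" and X: "X \<in> so n" "r < n" "s < n"
  shows "X $$ (r, s) = (\<Sum>b\<in>B. mat_trace (X * d b) * b $$ (r, s))"
  using coords_so[of B n X r s] coords_eq_trace_dual[OF D X(1)] D X
  by (simp add: so_dual_bases_def)

text \<open>The coordinate functional at \<open>b\<close> has to be represented as \<open>X \<mapsto> Tr(X (d b))\<close>. With any given pair
  of dual bases \<open>(E, e)\<close> the matrix that represents a linear functional \<open>\<lambda>\<close> is \<open>\<Sum>c\<in>E. \<lambda>(c) e c\<close>, because
  \<open>X = \<Sum>c\<in>E. Tr(X (e c)) c\<close>.\<close>

lemma so_basis_has_dual: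
  fixes B :: "'a :: field_char_0 mat set"
  assumes bas: "so_basis n B"
  shows "\<exists>d. so_dual_bases n B d"
proof -
  obtain E e where D: "so_dual_bases n E (e :: 'a mat \<Rightarrow> 'a mat)"
    using so_dual_bases_exist by blast
  have E: "so_basis n E" using D by (simp add: so_dual_bases_def)
  have e: "e c \<in> so n" if "c \<in> E" for c using D that by (auto simp: so_dual_bases_def)
  note Bso = so_basis_subset[OF bas] and Eso = so_basis_subset[OF E]
  let ?k = "coords (so_space n) B"
  define d where "d b = mat n n (\<lambda>q. \<Sum>c\<in>E. ?k c b * e c $$ q)" for b
  have dso: "d b \<in> so n" for b
    unfolding d_def
  proof (rule soI)
    fix r s assume rs: "r < n" "s < n"
    have "(\<Sum>c\<in>E. ?k c b * e c $$ (s, r)) = (\<Sum>c\<in>E. - (?k c b * e c $$ (r, s)))"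
      by (intro sum.cong refl, subst so_skew[OF e rs]) auto
    then show "mat n n (\<lambda>q. \<Sum>c\<in>E. ?k c b * e c $$ q) $$ (s, r) =
        - mat n n (\<lambda>q. \<Sum>c\<in>E. ?k c b * e c $$ q) $$ (r, s)"
      using rs by (simp add: sum_negf)
  qed simp
  have "mat_trace (a * d b) = (if a = b then 1 else 0)" if a: "a \<in> B" and b: "b \<in> B" for a b
  proof -
    have aso: "a \<in> so n" using a Bso by auto
    have "mat_trace (a * d b) = (\<Sum>r<n. \<Sum>s<n. \<Sum>c\<in>E. ?k c b * (a $$ (r, s) * e c $$ (s, r)))"
      by (subst mat_trace_mult[OF so_carrier[OF aso] so_carrier[OF dso]])
        (auto simp: d_def sum_distrib_left mult_ac intro!: sum.cong)
    also have "\<dots> = (\<Sum>c\<in>E. ?k c b * mat_trace (a * e c))"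
      using aso e by (simp add: sum.swap[of _ E] mat_trace_mult[of _ n] so_carrier sum_distrib_left)
    also have "\<dots> = ?k a b"
    proof (rule coords_so_unique[OF bas aso b, symmetric])
      fix r s assume rs: "r < n" "s < n"
      have "a $$ (r, s) = (\<Sum>c\<in>E. mat_trace (a * e c) * c $$ (r, s))"
        by (rule dual_bases_expansion[OF D aso rs])
      also have "\<dots> = (\<Sum>c\<in>E. \<Sum>b\<in>B. ?k c b * mat_trace (a * e c) * b $$ (r, s))"
        using Eso by (intro sum.cong refl, subst coords_so[OF bas _ rs])
          (auto simp: sum_distrib_left mult_ac)
      also have "\<dots> = (\<Sum>b\<in>B. (\<Sum>c\<in>E. ?k c b * mat_trace (a * e c)) * b $$ (r, s))"
        by (subst sum.swap) (simp add: sum_distrib_right)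
      finally show "a $$ (r, s) = (\<Sum>b\<in>B. (\<Sum>c\<in>E. ?k c b * mat_trace (a * e c)) * b $$ (r, s))" .
    qed
    also have "\<dots> = (if a = b then 1 else 0)"
      by (rule coords_so_unique[OF bas aso b, where c = "\<lambda>b. if a = b then 1 else 0"])
        (use a bas in \<open>simp add: if_distrib[of "\<lambda>z. z * _"] cong: if_cong\<close>)
    finally show ?thesis .
  qed
  then have "so_dual_bases n B d" using bas dso by (simp add: so_dual_bases_def)
  then show ?thesis by blast
qed

text \<open>The basis chosen inside \<open>operator_trace\<close> is unknown, but it has a dual basis. This
  replaces coordinates by traces, to which the completeness relation below applies whatever the
  basis is.\<close>

lemma operator_trace_so:
  shows "\<exists>B d. so_dual_bases n B (d :: 'a :: field_char_0 mat \<Rightarrow> 'a mat) \<and>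
    (\<forall>L \<in> so n \<rightarrow> so n. operator_trace (so_space n) L = (\<Sum>b\<in>B. mat_trace (L b * d b)))"
proof -
  define B :: "'a mat set" where "B = (SOME B. so_basis n B)"
  have bas: "so_basis n B"
    unfolding B_def using so_dual_bases_exist[of n, where 'a='a]
    by (intro someI_ex[of "so_basis n"]) (auto simp: so_dual_bases_def)
  obtain d where D: "so_dual_bases n B d" using so_basis_has_dual[OF bas] by blast
  have "operator_trace (so_space n) L = (\<Sum>b\<in>B. mat_trace (L b * d b))" if "L \<in> so n \<rightarrow> so n" for L
    unfolding operator_trace_def Let_def B_def[symmetric] using that so_basis_subset[OF bas]
    by (intro sum.cong refl coords_eq_trace_dual[OF D]) auto
  then show ?thesis using D by blast
qed

section \<open>The completeness relation and contraction of two matrices\<close>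

text \<open>The tensor \<open>\<Sum>b. b \<otimes> d b\<close> does not depend on the basis. It comes out of expanding the
  skew matrix \<open>E\<^bsub>ut\<^esub> - E\<^bsub>tu\<^esub>\<close> in the basis, since the trace of this matrix times \<open>d b\<close> is twice
  the entry of \<open>d b\<close> at \<open>(t, u)\<close>.\<close>

lemma dual_bases_completeness:
  fixes B :: "'a :: field_char_0 mat set"
  assumes D: "so_dual_bases n B d" and lt: "r < n" "s < n" "t < n" "u < n"
  shows "(\<Sum>b\<in>B. b $$ (r, s) * d b $$ (t, u)) =
    ((if r = u \<and> s = t then 1 else 0) - (if r = t \<and> s = u then 1 else 0)) / 2"
proof -
  define X :: "'a mat" where
    "X = mat n n (\<lambda>(i, j). (if i = u \<and> j = t then 1 else 0) - (if i = t \<and> j = u then 1 else 0))"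
  have X: "X \<in> so n" unfolding X_def by (rule soI) (simp_all add: conj_commute split del: if_split)
  have tr: "mat_trace (X * d b) = 2 * d b $$ (t, u)" if b: "b \<in> B" for b
  proof -
    have db: "d b \<in> so n" using D b by (auto simp: so_dual_bases_def)
    have "mat_trace (X * d b) = (\<Sum>i<n. \<Sum>j<n. X $$ (i, j) * d b $$ (j, i))"
      by (intro mat_trace_mult so_carrier X db)
    also have "\<dots> = (\<Sum>i<n. \<Sum>j<n. (if i = u then if j = t then d b $$ (t, u) else 0 else 0)
        - (if i = t then if j = u then d b $$ (u, t) else 0 else 0))"
      by (intro sum.cong refl) (auto simp: X_def)
    also have "\<dots> = (\<Sum>i<n. (if i = u then d b $$ (t, u) else 0) - (if i = t then d b $$ (u, t) else 0))"
      using lt by (intro sum.cong) (auto simp: sum_subtractf)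
    also have "\<dots> = d b $$ (t, u) - d b $$ (u, t)" using lt by (simp add: sum_subtractf)
    also have "\<dots> = 2 * d b $$ (t, u)" using so_skew[OF db lt(3,4)] by simp
    finally show ?thesis .
  qed
  have "X $$ (r, s) = (\<Sum>b\<in>B. 2 * d b $$ (t, u) * b $$ (r, s))"
    unfolding dual_bases_expansion[OF D X lt(1,2)] by (intro sum.cong refl) (simp add: tr)
  also have "\<dots> = 2 * (\<Sum>b\<in>B. b $$ (r, s) * d b $$ (t, u))"
    by (simp add: sum_distrib_left mult_ac)
  finally show ?thesis using lt by (simp add: X_def)
qed

lemma dual_bases_contract_entries:
  fixes B :: "'a :: field_char_0 mat set"
  assumes D: "so_dual_bases n B d"
  shows "(\<Sum>b\<in>B. \<Sum>r<n. \<Sum>s<n. \<Sum>t<n. \<Sum>u<n. K r s t u * (b $$ (r, s) * d b $$ (t, u))) =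
    ((\<Sum>r<n. \<Sum>s<n. K r s s r) - (\<Sum>r<n. \<Sum>s<n. K r s r s)) / 2"
proof -
  have "(\<Sum>b\<in>B. \<Sum>r<n. \<Sum>s<n. \<Sum>t<n. \<Sum>u<n. K r s t u * (b $$ (r, s) * d b $$ (t, u))) =
    (\<Sum>r<n. \<Sum>s<n. \<Sum>t<n. \<Sum>u<n. K r s t u * (\<Sum>b\<in>B. b $$ (r, s) * d b $$ (t, u)))"
    by (simp add: sum_distrib_left sum.swap[of _ _ B])
  also have "\<dots> = (\<Sum>r<n. \<Sum>s<n. \<Sum>t<n. \<Sum>u<n.
      (if t = s then if u = r then K r s t u / 2 else 0 else 0)
      - (if t = r then if u = s then K r s t u / 2 else 0 else 0))"
    by (intro sum.cong refl) (auto simp: dual_bases_completeness[OF D])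
  also have "\<dots> = (\<Sum>r<n. \<Sum>s<n. \<Sum>t<n.
      (if t = s then K r s t r / 2 else 0) - (if t = r then K r s t s / 2 else 0))"
    by (intro sum.cong refl) (auto simp: sum_subtractf)
  also have "\<dots> = (\<Sum>r<n. \<Sum>s<n. K r s s r / 2 - K r s r s / 2)"
    by (intro sum.cong refl) (auto simp: sum_subtractf)
  finally show ?thesis by (simp add: sum_subtractf sum_divide_distrib diff_divide_distrib)
qed

text \<open>Of the two terms of the completeness relation, one glues the two traces with the same
  orientation, the other with the orientation of one of them reversed. In the next lemma the same
  two terms cut one trace into two, or reverse one of its two arcs.\<close>

lemma contract_two_traces:
  fixes B :: "'a :: field_char_0 mat set"
  assumes D: "so_dual_bases n B d" and A: "A \<in> carrier_mat n n" and C: "C \<in> carrier_mat n n"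
  shows "(\<Sum>b\<in>B. mat_trace (A * b) * mat_trace (C * d b)) =
    (mat_trace (A * C) - mat_trace (A * transpose_mat C)) / 2"
proof -
  have "mat_trace (A * b) * mat_trace (C * d b) =
    (\<Sum>r<n. \<Sum>s<n. \<Sum>t<n. \<Sum>u<n. A $$ (s, r) * C $$ (u, t) * (b $$ (r, s) * d b $$ (t, u)))"
    if "b \<in> B" for b
  proof -
    have c: "b \<in> carrier_mat n n" "d b \<in> carrier_mat n n"
      using D that so_basis_subset[of B n] by (auto simp: so_dual_bases_def intro: so_carrier)
    have "mat_trace (A * b) = (\<Sum>r<n. \<Sum>s<n. A $$ (s, r) * b $$ (r, s))"
      using c by (simp add: mat_trace_comm[OF A c(1)] mat_trace_mult[OF c(1) A] mult.commute)
    moreover have "mat_trace (C * d b) = (\<Sum>t<n. \<Sum>u<n. C $$ (u, t) * d b $$ (t, u))"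
      using c by (simp add: mat_trace_comm[OF C c(2)] mat_trace_mult[OF c(2) C] mult.commute)
    ultimately show ?thesis
      by (simp only: sum_distrib_right) (simp add: sum_distrib_left mult_ac)
  qed
  then have "(\<Sum>b\<in>B. mat_trace (A * b) * mat_trace (C * d b)) =
    ((\<Sum>r<n. \<Sum>s<n. A $$ (s, r) * C $$ (r, s)) - (\<Sum>r<n. \<Sum>s<n. A $$ (s, r) * C $$ (s, r))) / 2"
    by (simp add: dual_bases_contract_entries[OF D, of "\<lambda>r s t u. A $$ (s, r) * C $$ (u, t)"])
  also have "(\<Sum>r<n. \<Sum>s<n. A $$ (s, r) * C $$ (r, s)) = mat_trace (A * C)"
    unfolding mat_trace_mult[OF A C] by (rule sum.swap)
  also have "(\<Sum>r<n. \<Sum>s<n. A $$ (s, r) * C $$ (s, r)) = mat_trace (A * transpose_mat C)"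
    using A C by (subst sum.swap) (simp add: mat_trace_mult[of _ n])
  finally show ?thesis .
qed

lemma contract_one_trace:
  fixes B :: "'a :: field_char_0 mat set"
  assumes D: "so_dual_bases n B d" and A: "A \<in> carrier_mat n n" and C: "C \<in> carrier_mat n n"
  shows "(\<Sum>b\<in>B. mat_trace (A * b * C * d b)) =
    (mat_trace A * mat_trace C - mat_trace (A * transpose_mat C)) / 2"
proof -
  have "mat_trace (A * b * C * d b) =
    (\<Sum>r<n. \<Sum>s<n. \<Sum>t<n. \<Sum>u<n. A $$ (u, r) * C $$ (s, t) * (b $$ (r, s) * d b $$ (t, u)))"
    if "b \<in> B" for b
  proof -
    have c: "b \<in> carrier_mat n n" "d b \<in> carrier_mat n n"
      using D that so_basis_subset[of B n] by (auto simp: so_dual_bases_def intro: so_carrier)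
    have "mat_trace (A * b * C * d b) = mat_trace ((b * C) * (d b * A))"
      using mat_trace_comm[of A n "b * C * d b"] c A C by (simp add: assoc_mult_mat[of _ n n _ n _ n])
    also have "\<dots> = (\<Sum>r<n. \<Sum>t<n. (\<Sum>s<n. b $$ (r, s) * C $$ (s, t)) * (\<Sum>u<n. d b $$ (t, u) * A $$ (u, r)))"
      using c A C by (subst mat_trace_mult[of _ n]) (auto simp: scalar_prod_def atLeast0LessThan)
    also have "\<dots> = (\<Sum>r<n. \<Sum>t<n. \<Sum>s<n. \<Sum>u<n. A $$ (u, r) * C $$ (s, t) * (b $$ (r, s) * d b $$ (t, u)))"
      by (simp add: sum_product mult_ac)
    also have "\<dots> = (\<Sum>r<n. \<Sum>s<n. \<Sum>t<n. \<Sum>u<n. A $$ (u, r) * C $$ (s, t) * (b $$ (r, s) * d b $$ (t, u)))"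
      by (intro sum.cong refl sum.swap)
    finally show ?thesis .
  qed
  then have "(\<Sum>b\<in>B. mat_trace (A * b * C * d b)) =
    ((\<Sum>r<n. \<Sum>s<n. A $$ (r, r) * C $$ (s, s)) - (\<Sum>r<n. \<Sum>s<n. A $$ (s, r) * C $$ (s, r))) / 2"
    by (simp add: dual_bases_contract_entries[OF D, of "\<lambda>r s t u. A $$ (u, r) * C $$ (s, t)"])
  also have "(\<Sum>r<n. \<Sum>s<n. A $$ (r, r) * C $$ (s, s)) = mat_trace A * mat_trace C"
    using A C by (simp add: mat_trace_def sum_product)
  also have "(\<Sum>r<n. \<Sum>s<n. A $$ (s, r) * C $$ (s, r)) = mat_trace (A * transpose_mat C)"
    using A C by (subst sum.swap) (simp add: mat_trace_mult[of _ n])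
  finally show ?thesis .
qed

section \<open>Words and trace monomials\<close>

definition mat_prod :: "nat \<Rightarrow> (nat \<Rightarrow> 'a :: field mat) \<Rightarrow> nat list \<Rightarrow> 'a mat" where
  "mat_prod n x w = word_mat n x (map Plain w)"

lemma mat_prod_Nil [simp]: "mat_prod n x [] = 1\<^sub>m n"
  and mat_prod_Cons [simp]: "mat_prod n x (i # w) = x i * mat_prod n x w"
  by (simp_all add: mat_prod_def word_mat_def)

lemma mat_prod_carrier:
  "x \<in> set w \<rightarrow> so n \<Longrightarrow> mat_prod n x w \<in> carrier_mat n n"
  by (induction w) (auto intro: mult_carrier_mat[of _ n n] so_carrier)

lemma mat_prod_append:
  "x \<in> set (v @ w) \<rightarrow> so n \<Longrightarrow> mat_prod n x (v @ w) = mat_prod n x v * mat_prod n x w"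
proof (induction v)
  case Nil
  then show ?case using mat_prod_carrier[of x w n] by simp
next
  case (Cons i v)
  then have "x i \<in> carrier_mat n n" "mat_prod n x v \<in> carrier_mat n n" "mat_prod n x w \<in> carrier_mat n n"
    by (auto intro: mat_prod_carrier so_carrier)
  with Cons show ?case by (simp add: assoc_mult_mat[of _ n n _ n _ n])
qed

lemma mat_prod_cong:
  "(\<And>i. i \<in> set w \<Longrightarrow> x i = y i) \<Longrightarrow> mat_prod n x w = mat_prod n y w"
  by (induction w) auto

text \<open>Transposes produced by the contraction formulas are removed here: on skew-symmetric
  arguments the transpose of a word is the reversed word up to sign.\<close>

lemma transpose_mat_prod:
  "x \<in> set w \<rightarrow> so n \<Longrightarrow>
    transpose_mat (mat_prod n x w) = (- 1) ^ length w \<cdot>\<^sub>m mat_prod n x (rev w)"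
proof (induction w)
  case Nil
  show ?case by (auto intro!: eq_matI)
next
  case (Cons i w)
  have c: "x i \<in> carrier_mat n n" "mat_prod n x w \<in> carrier_mat n n" "mat_prod n x (rev w) \<in> carrier_mat n n"
    using Cons.prems mat_prod_carrier[of x "rev w" n] by (auto intro: mat_prod_carrier so_carrier)
  have "transpose_mat (mat_prod n x (i # w)) = transpose_mat (mat_prod n x w) * transpose_mat (x i)"
    using transpose_mult[OF c(1,2)] by simp
  also have "transpose_mat (x i) = (- 1) \<cdot>\<^sub>m x i"
    using Cons.prems so_transpose[of "x i" n] by (auto intro!: eq_matI)
  also have "transpose_mat (mat_prod n x w) = (- 1) ^ length w \<cdot>\<^sub>m mat_prod n x (rev w)"
    using Cons by auto
  also have "\<dots> * ((- 1) \<cdot>\<^sub>m x i) = (- 1) ^ length (i # w) \<cdot>\<^sub>m (mat_prod n x (rev w) * x i)"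
    using c by (auto simp: mult_smult_assoc_mat[of _ n n _ n] mult_smult_distrib[of _ n n _ n] intro!: eq_matI)
  also have "mat_prod n x (rev w) * x i = mat_prod n x (rev (i # w))"
    using Cons.prems c by (subst rev.simps, subst mat_prod_append) auto
  finally show ?case .
qed

definition trace_monomial :: "nat \<Rightarrow> (nat \<Rightarrow> 'a :: field mat) \<Rightarrow> nat list list \<Rightarrow> 'a" where
  "trace_monomial n x T = (\<Prod>w\<leftarrow>T. mat_trace (mat_prod n x w))"

lemma trace_monomial_simps [simp]:
  "trace_monomial n x [] = 1"
  "trace_monomial n x (w # T) = mat_trace (mat_prod n x w) * trace_monomial n x T"
  by (simp_all add: trace_monomial_def)

lemma trace_monomial_append [simp]:
  "trace_monomial n x (S @ T) = trace_monomial n x S * trace_monomial n x T"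
  by (simp add: trace_monomial_def)

lemma trace_monomial_cong:
  "(\<And>i. i \<in> set (concat T) \<Longrightarrow> x i = y i) \<Longrightarrow> trace_monomial n x T = trace_monomial n y T"
  unfolding trace_monomial_def by (intro arg_cong[of _ _ prod_list] map_cong refl arg_cong[of _ _ mat_trace] mat_prod_cong) auto

text \<open>The factor that contains \<open>a\<close> can be rotated, by cyclicity of the trace, so that it starts
  with \<open>a\<close>.\<close>

lemma trace_monomial_extract:
  assumes "distinct (concat T)" "a \<in> set (concat T)"
  obtains u R where "distinct (a # u @ concat R)" "set (a # u @ concat R) = set (concat T)"
    "\<And>n x. x \<in> set (concat T) \<rightarrow> so n \<Longrightarrow>
      trace_monomial n x T = mat_trace (mat_prod n x (a # u)) * trace_monomial n x R"
proof -
  obtain w where w: "w \<in> set T" "a \<in> set w" using assms(2) by auto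
  obtain T1 T2 where T: "T = T1 @ w # T2" using split_list[OF w(1)] by blast
  obtain p q where pq: "w = p @ a # q" using split_list[OF w(2)] by blast
  show ?thesis
  proof (rule that[of "q @ p" "T1 @ T2"])
    show "distinct (a # (q @ p) @ concat (T1 @ T2))" using assms(1) unfolding T pq by auto
    show "set (a # (q @ p) @ concat (T1 @ T2)) = set (concat T)" unfolding T pq by auto
    fix n and x :: "nat \<Rightarrow> 'b :: field mat" assume x: "x \<in> set (concat T) \<rightarrow> so n"
    have "mat_trace (mat_prod n x (p @ a # q)) = mat_trace (mat_prod n x ((a # q) @ p))"
      using x unfolding T pq
      by (subst (1 2) mat_prod_append) (auto intro!: mat_trace_comm[of _ n] mat_prod_carrier simp del: mat_prod_Cons)
    then show "trace_monomial n x T = mat_trace (mat_prod n x (a # q @ p)) * trace_monomial n x (T1 @ T2)"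
      unfolding T pq by simp
  qed
qed

section \<open>Polynomial combinations of trace monomials\<close>

text \<open>\<open>trace_form I F\<close> says that \<open>F\<close> is, for all \<open>n\<close> at once, one sum of multilinear trace monomials with
  coefficients polynomial in \<open>n\<close>. That every index of \<open>I\<close> occurs exactly once in each monomial is
  what makes the contraction of a pair meaningful. Words may be empty here, because contraction
  produces traces of the identity; these become powers of \<open>n\<close> only at the very end. Values off
  \<open>so n\<close> are left open, so that skew-symmetry may be used to rewrite \<open>F\<close>.\<close>

inductive trace_form :: "nat set \<Rightarrow> (nat \<Rightarrow> (nat \<Rightarrow> 'a :: field_char_0 mat) \<Rightarrow> 'a) \<Rightarrow> bool" for I where
  monomial: "distinct (concat T) \<Longrightarrow> set (concat T) = I \<Longrightarrow>
    (\<And>n x. x \<in> I \<rightarrow> so n \<Longrightarrow> F n x = poly p (of_nat n) * trace_monomial n x T) \<Longrightarrow> trace_form I F"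
| add: "trace_form I F \<Longrightarrow> trace_form I G \<Longrightarrow>
    (\<And>n x. x \<in> I \<rightarrow> so n \<Longrightarrow> H n x = F n x + G n x) \<Longrightarrow> trace_form I H"

lemma trace_form_scale:
  "trace_form I F \<Longrightarrow> trace_form I (\<lambda>n x. poly p (of_nat n) * F n x)"
proof (induction rule: trace_form.induct)
  case (monomial T F q)
  then show ?case by (intro trace_form.monomial[of T I _ "p * q"]) auto
next
  case (add F G H)
  show ?case by (rule trace_form.add[OF add.IH]) (simp add: add.hyps distrib_left)
qed

text \<open>The zero form that is needed as second summand is taken to be a multiple of \<open>F\<close>: for infinite
  \<open>I\<close> there is no monomial at all.\<close>

lemma trace_form_cong:
  assumes "trace_form I F" "\<And>n x. x \<in> I \<rightarrow> so n \<Longrightarrow> H n x = F n x"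
  shows "trace_form I H"
  by (rule trace_form.add[OF assms(1) trace_form_scale[OF assms(1), of 0]]) (simp add: assms(2))

lemma trace_form_lincomb:
  assumes "trace_form I F" "trace_form I G"
  shows "trace_form I (\<lambda>n x. a * F n x + b * G n x)"
  by (rule trace_form.add[OF trace_form_scale[OF assms(1), of "[:a:]"] trace_form_scale[OF assms(2), of "[:b:]"]]) simp

lemma trace_form_monomial:
  "distinct (concat T) \<Longrightarrow> set (concat T) = I \<Longrightarrow> trace_form I (\<lambda>n x. trace_monomial n x T)"
  by (rule trace_form.monomial[of T I _ 1]) auto

section \<open>Contraction preserves trace forms\<close>

text \<open>The cases are whether \<open>a\<close> and \<open>b\<close> lie in the same trace or in different ones. In the first
  case the cyclic word is \<open>a s b r\<close>, and the contraction yields half of the difference of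
  \<open>Tr(r) Tr(s)\<close> and \<open>Tr(r s\<^sup>T)\<close>. In the second case the words are \<open>a u\<close> and \<open>b v\<close>, with the result
  half of the difference of \<open>Tr(u v)\<close> and \<open>Tr(u v\<^sup>T)\<close>. The sign in the definition of \<open>G\<close> combines
  this minus with the sign from reversing the transposed word.\<close>

lemma contract_monomial:
  assumes T: "distinct (concat T)" "set (concat T) = I" and ab: "a \<in> I" "b \<in> I" "a \<noteq> b"
  shows "\<exists>G. trace_form (I - {a, b}) G \<and>
    (\<forall>n B d x. so_dual_bases n B d \<longrightarrow> x \<in> (I - {a, b}) \<rightarrow> so n \<longrightarrow>
      (\<Sum>\<alpha>\<in>B. trace_monomial n (x(a := \<alpha>, b := d \<alpha>)) T) = (G n x :: 'a :: field_char_0))"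
proof -
  obtain u R where R: "distinct (a # u @ concat R)" "set (a # u @ concat R) = I"
    and TR: "\<And>n x :: nat \<Rightarrow> 'a mat. x \<in> I \<rightarrow> so n \<Longrightarrow>
      trace_monomial n x T = mat_trace (mat_prod n x (a # u)) * trace_monomial n x R"
    using trace_monomial_extract[OF T(1), of a] ab(1) unfolding T(2) by metis
  have upd: "x(a := \<alpha>, b := d \<alpha>) \<in> I \<rightarrow> so n"
    if "so_dual_bases n B d" "x \<in> (I - {a, b}) \<rightarrow> so n" "\<alpha> \<in> B"
    for n B d \<alpha> and x :: "nat \<Rightarrow> 'a mat"
    using that so_basis_subset[of B n] by (auto simp: so_dual_bases_def)
  show ?thesis
  proof (cases "b \<in> set u")
    case True
    then obtain s r where u: "u = s @ b # r" using split_list by metis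
    have dis: "distinct (concat R)" "distinct s" "distinct r" "set s \<inter> set r = {}"
        "set s \<inter> set (concat R) = {}" "set r \<inter> set (concat R) = {}"
      and new: "a \<notin> set s \<union> set r \<union> set (concat R)" "b \<notin> set s \<union> set r \<union> set (concat R)"
      using R(1) by (auto simp: u)
    have "I = {a, b} \<union> (set s \<union> set r \<union> set (concat R))" using R(2) by (auto simp: u)
    then have I: "I - {a, b} = set s \<union> set r \<union> set (concat R)" using new by blast
    define G :: "nat \<Rightarrow> (nat \<Rightarrow> 'a mat) \<Rightarrow> 'a" where
      "G = (\<lambda>n x. 1 / 2 * trace_monomial n x ([r, s] @ R)
        + (- 1) ^ Suc (length s) / 2 * trace_monomial n x ([r @ rev s] @ R))"
    have "trace_form (I - {a, b}) G"
      unfolding G_def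
      by (rule trace_form_lincomb[OF trace_form_monomial trace_form_monomial])
        (use dis in \<open>simp_all add: I Int_Un_distrib Int_Un_distrib2 ball_Un Un_ac insert_Diff_if Int_commute\<close>)
    moreover have "(\<Sum>\<alpha>\<in>B. trace_monomial n (x(a := \<alpha>, b := d \<alpha>)) T) = G n x"
      if D: "so_dual_bases n B d" and x: "x \<in> (I - {a, b}) \<rightarrow> so n" for n B d x
    proof -
      have xs: "x \<in> set s \<rightarrow> so n" and xr: "x \<in> set r \<rightarrow> so n" using x R by (auto simp: u)
      note c = mat_prod_carrier[OF xs] mat_prod_carrier[OF xr]
      have xs': "x \<in> set (rev s) \<rightarrow> so n" using xs by simp
      note c = c mat_prod_carrier[OF xs']
      have "trace_monomial n (x(a := \<alpha>, b := d \<alpha>)) T =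
        mat_trace (mat_prod n x r * \<alpha> * mat_prod n x s * d \<alpha>) * trace_monomial n x R"
        if "\<alpha> \<in> B" for \<alpha>
      proof -
        let ?y = "x(a := \<alpha>, b := d \<alpha>)"
        have y: "?y \<in> I \<rightarrow> so n" by (rule upd[OF D x that])
        have \<alpha>: "\<alpha> \<in> carrier_mat n n" "d \<alpha> \<in> carrier_mat n n"
          using y ab so_carrier by (force simp: Pi_iff)+
        have e: "mat_prod n ?y s = mat_prod n x s" "mat_prod n ?y r = mat_prod n x r"
            "trace_monomial n ?y R = trace_monomial n x R"
          using R by (auto simp: u intro!: mat_prod_cong trace_monomial_cong)
        have "mat_prod n ?y (a # u) = \<alpha> * (mat_prod n x s * (d \<alpha> * mat_prod n x r))"
          unfolding u mat_prod_Cons using R y ab e by (subst mat_prod_append) (auto simp: u)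
        also have "\<dots> = (\<alpha> * mat_prod n x s * d \<alpha>) * mat_prod n x r"
          using \<alpha> c by (simp add: assoc_mult_mat[of _ n n _ n _ n])
        also have "mat_trace \<dots> = mat_trace (mat_prod n x r * (\<alpha> * mat_prod n x s * d \<alpha>))"
          using \<alpha> c by (intro mat_trace_comm[of _ n]) auto
        also have "mat_prod n x r * (\<alpha> * mat_prod n x s * d \<alpha>) = mat_prod n x r * \<alpha> * mat_prod n x s * d \<alpha>"
          using \<alpha> c by (simp add: assoc_mult_mat[of _ n n _ n _ n])
        finally show ?thesis unfolding TR[OF y] e by (rule arg_cong)
      qed
      then have "(\<Sum>\<alpha>\<in>B. trace_monomial n (x(a := \<alpha>, b := d \<alpha>)) T) =
        (\<Sum>\<alpha>\<in>B. mat_trace (mat_prod n x r * \<alpha> * mat_prod n x s * d \<alpha>)) * trace_monomial n x R"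
        by (simp add: sum_distrib_right)
      also have "\<dots> = G n x"
        using c xs xr
        by (simp add: contract_one_trace[OF D] transpose_mat_prod mult_smult_distrib[of _ n n _ n]
            mat_trace_smult[of _ n] mat_prod_append G_def field_simps Pi_iff ball_Un)
      finally show ?thesis .
    qed
    ultimately show ?thesis by blast
  next
    case False
    then have b: "b \<in> set (concat R)" using ab R by auto
    obtain v S where S: "distinct (b # v @ concat S)" "set (b # v @ concat S) = set (concat R)"
      and RS: "\<And>n x :: nat \<Rightarrow> 'a mat. x \<in> set (concat R) \<rightarrow> so n \<Longrightarrow>
        trace_monomial n x R = mat_trace (mat_prod n x (b # v)) * trace_monomial n x S"
      using trace_monomial_extract[OF _ b] R by (metis distinct.simps(2) distinct_append)
    have dis: "a \<notin> set u" "a \<notin> set (concat R)" "set u \<inter> set (concat R) = {}" "distinct u"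
      and I: "I = insert a (set u \<union> set (concat R))" using R by auto
    note dis = dis(1) dis(2,3)[folded S(2)] dis(4) and I = I[folded S(2)]
    define G :: "nat \<Rightarrow> (nat \<Rightarrow> 'a mat) \<Rightarrow> 'a" where
      "G = (\<lambda>n x. 1 / 2 * trace_monomial n x ([u @ v] @ S)
        + (- 1) ^ Suc (length v) / 2 * trace_monomial n x ([u @ rev v] @ S))"
    have "trace_form (I - {a, b}) G"
      unfolding G_def
      by (rule trace_form_lincomb[OF trace_form_monomial trace_form_monomial])
        (use dis S(1) False ab(3) in \<open>auto simp: I\<close>)
    moreover have "(\<Sum>\<alpha>\<in>B. trace_monomial n (x(a := \<alpha>, b := d \<alpha>)) T) = G n x"
      if D: "so_dual_bases n B d" and x: "x \<in> (I - {a, b}) \<rightarrow> so n" for n B d x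
    proof -
      have xu: "x \<in> set u \<rightarrow> so n" and xv: "x \<in> set v \<rightarrow> so n"
        using x dis S(1) False ab(3) by (auto simp: I)
      have xv': "x \<in> set (rev v) \<rightarrow> so n" using xv by simp
      note c = mat_prod_carrier[OF xu] mat_prod_carrier[OF xv] mat_prod_carrier[OF xv']
      have "trace_monomial n (x(a := \<alpha>, b := d \<alpha>)) T =
        mat_trace (mat_prod n x u * \<alpha>) * mat_trace (mat_prod n x v * d \<alpha>) * trace_monomial n x S"
        if "\<alpha> \<in> B" for \<alpha>
      proof -
        let ?y = "x(a := \<alpha>, b := d \<alpha>)"
        have y: "?y \<in> I \<rightarrow> so n" by (rule upd[OF D x that])
        then have yR: "?y \<in> set (concat R) \<rightarrow> so n" using R(2) by (auto simp: Pi_iff simp del: fun_upd_apply)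
        have \<alpha>: "\<alpha> \<in> carrier_mat n n" "d \<alpha> \<in> carrier_mat n n"
          using y ab so_carrier by (force simp: Pi_iff)+
        have e: "mat_prod n ?y u = mat_prod n x u" "mat_prod n ?y v = mat_prod n x v"
            "trace_monomial n ?y S = trace_monomial n x S"
          using dis S(1) False by (auto intro!: mat_prod_cong trace_monomial_cong)
        show ?thesis
          using TR[OF y] RS[OF yR] e ab(3) mat_trace_comm[OF \<alpha>(1) c(1)] mat_trace_comm[OF \<alpha>(2) c(2)] by simp
      qed
      then have "(\<Sum>\<alpha>\<in>B. trace_monomial n (x(a := \<alpha>, b := d \<alpha>)) T) =
        (\<Sum>\<alpha>\<in>B. mat_trace (mat_prod n x u * \<alpha>) * mat_trace (mat_prod n x v * d \<alpha>)) * trace_monomial n x S"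
        by (simp add: sum_distrib_right)
      also have "\<dots> = G n x"
        using c xu xv
        by (simp add: contract_two_traces[OF D] transpose_mat_prod mult_smult_distrib[of _ n n _ n]
            mat_trace_smult[of _ n] mat_prod_append G_def field_simps Pi_iff ball_Un)
      finally show ?thesis .
    qed
    ultimately show ?thesis by blast
  qed
qed

lemma contract_pair:
  assumes F: "trace_form I F" and ab: "a \<in> I" "b \<in> I" "a \<noteq> b"
  shows "\<exists>G. trace_form (I - {a, b}) G \<and>
    (\<forall>n B d x. so_dual_bases n B d \<longrightarrow> x \<in> (I - {a, b}) \<rightarrow> so n \<longrightarrow>
      (\<Sum>\<alpha>\<in>B. F n (x(a := \<alpha>, b := d \<alpha>))) = (G n x :: 'a :: field_char_0))"
proof -
  have upd: "x(a := \<alpha>, b := d \<alpha>) \<in> I \<rightarrow> so n"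
    if "so_dual_bases n B d" "x \<in> (I - {a, b}) \<rightarrow> so n" "\<alpha> \<in> B"
    for n B d \<alpha> and x :: "nat \<Rightarrow> 'a mat"
    using that so_basis_subset[of B n] by (auto simp: so_dual_bases_def)
  from F show ?thesis
  proof (induction rule: trace_form.induct)
    case (monomial T F p)
    obtain G where G: "trace_form (I - {a, b}) G"
      and eq: "\<And>n B d x. so_dual_bases n B d \<Longrightarrow> x \<in> (I - {a, b}) \<rightarrow> so n \<Longrightarrow>
        (\<Sum>\<alpha>\<in>B. trace_monomial n (x(a := \<alpha>, b := d \<alpha>)) T) = (G n x :: 'a)"
      using contract_monomial[OF monomial(1,2) ab] by blast
    have "(\<Sum>\<alpha>\<in>B. F n (x(a := \<alpha>, b := d \<alpha>))) = poly p (of_nat n) * G n x"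
      if "so_dual_bases n B d" "x \<in> (I - {a, b}) \<rightarrow> so n" for n B d x
      unfolding eq[OF that, symmetric] sum_distrib_left
      by (intro sum.cong refl monomial(3) upd[OF that])
    with trace_form_scale[OF G] show ?case by blast
  next
    case (add F1 F2 H)
    obtain G1 where G1: "trace_form (I - {a, b}) G1"
      and eq1: "\<And>n B d x. so_dual_bases n B d \<Longrightarrow> x \<in> (I - {a, b}) \<rightarrow> so n \<Longrightarrow>
        (\<Sum>\<alpha>\<in>B. F1 n (x(a := \<alpha>, b := d \<alpha>))) = (G1 n x :: 'a)"
      using add.IH(1) by blast
    obtain G2 where G2: "trace_form (I - {a, b}) G2"
      and eq2: "\<And>n B d x. so_dual_bases n B d \<Longrightarrow> x \<in> (I - {a, b}) \<rightarrow> so n \<Longrightarrow>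
        (\<Sum>\<alpha>\<in>B. F2 n (x(a := \<alpha>, b := d \<alpha>))) = (G2 n x :: 'a)"
      using add.IH(2) by blast
    have "(\<Sum>\<alpha>\<in>B. H n (x(a := \<alpha>, b := d \<alpha>))) = G1 n x + G2 n x"
      if "so_dual_bases n B d" "x \<in> (I - {a, b}) \<rightarrow> so n" for n B d x
      unfolding eq1[OF that, symmetric] eq2[OF that, symmetric] sum.distrib[symmetric]
      by (intro sum.cong refl add.hyps(3) upd[OF that])
    moreover have "trace_form (I - {a, b}) (\<lambda>n x. G1 n x + G2 n x)"
      by (rule trace_form.add[OF G1 G2]) simp
    ultimately show ?case by blast
  qed
qed

lemma plug_in_pair:
  assumes "pairwise disjnt \<pi>" "P \<in> \<pi>" "i \<in> P"
  shows "plug \<pi> d \<phi> x i = (if i = Min P then \<phi> P else d (\<phi> P))"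
proof -
  have "(THE Q. Q \<in> \<pi> \<and> i \<in> Q) = P"
  proof (rule the_equality)
    fix Q assume "Q \<in> \<pi> \<and> i \<in> Q"
    then show "Q = P" using pairwiseD[OF assms(1), of Q P] assms(2,3) by (auto simp: disjnt_iff)
  qed (use assms in simp)
  moreover have "i \<in> \<Union>\<pi>" using assms(2,3) by blast
  ultimately show ?thesis by (simp only: plug_def Let_def if_True)
qed

lemma plug_free: "i \<notin> \<Union>\<pi> \<Longrightarrow> plug \<pi> d \<phi> x i = x i"
  by (simp only: plug_def if_False)

lemma plug_insert:
  assumes disj: "pairwise disjnt (insert P \<pi>)" and P: "P \<notin> \<pi>" "P = {a, b}" "a < b"
  shows "plug (insert P \<pi>) d (\<phi>(P := \<alpha>)) x = plug \<pi> d \<phi> (x(a := \<alpha>, b := d \<alpha>))"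
proof
  fix i
  have disj': "pairwise disjnt \<pi>" using disj by (simp add: pairwise_insert)
  have PU: "P \<inter> \<Union>\<pi> = {}" using disj P(1) by (auto simp: pairwise_insert disjnt_def)
  consider Q where "Q \<in> \<pi>" "i \<in> Q" | "i \<in> P" | "i \<notin> \<Union>(insert P \<pi>)" by blast
  then show "plug (insert P \<pi>) d (\<phi>(P := \<alpha>)) x i = plug \<pi> d \<phi> (x(a := \<alpha>, b := d \<alpha>)) i"
  proof cases
    case 1
    have "Q \<noteq> P" using 1 P(1) by blast
    then show ?thesis
      using 1 by (simp add: plug_in_pair[OF disj, of Q i] plug_in_pair[OF disj' 1])
  next
    case 2
    then have i: "i \<notin> \<Union>\<pi>" using PU by blast
    have "Min P = a" using P(2,3) by simp
    then show ?thesis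
      unfolding plug_in_pair[OF disj insertI1 2] plug_free[OF i] using 2 P(2,3) by auto
  next
    case 3
    then show ?thesis
      using P(2) by (simp add: plug_free)
  qed
qed

text \<open>The simultaneous sum over all choices for the pairs is an iterated one: the choice for \<open>P\<close> acts
  on the arguments first, and the remaining pairs are contracted with these new arguments.\<close>

lemma contract_insert:
  assumes "finite \<pi>" "pairwise disjnt (insert P \<pi>)" "P \<notin> \<pi>" "P = {a, b}" "a < b"
  shows "contract B d (insert P \<pi>) f x = (\<Sum>\<alpha>\<in>B. contract B d \<pi> f (x(a := \<alpha>, b := d \<alpha>)))"
proof -
  have "contract B d (insert P \<pi>) f x =
    (\<Sum>(\<alpha>, \<phi>)\<in>B \<times> (\<pi> \<rightarrow>\<^sub>E B). f (plug (insert P \<pi>) d (\<phi>(P := \<alpha>)) x))"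
    unfolding contract_def PiE_insert_eq
    by (subst sum.reindex[OF inj_combinator[OF assms(3)]]) (simp add: case_prod_unfold)
  also have "\<dots> = (\<Sum>(\<alpha>, \<phi>)\<in>B \<times> (\<pi> \<rightarrow>\<^sub>E B). f (plug \<pi> d \<phi> (x(a := \<alpha>, b := d \<alpha>))))"
    by (simp add: plug_insert[OF assms(2-)])
  also have "\<dots> = (\<Sum>\<alpha>\<in>B. contract B d \<pi> f (x(a := \<alpha>, b := d \<alpha>)))"
    by (simp add: contract_def sum.cartesian_product)
  finally show ?thesis .
qed

lemma contract_trace_form:
  fixes F :: "nat \<Rightarrow> (nat \<Rightarrow> 'a :: field_char_0 mat) \<Rightarrow> 'a"
  assumes F: "trace_form I F" and "finite \<pi>" "\<forall>P\<in>\<pi>. P \<subseteq> I \<and> card P = 2" "pairwise disjnt \<pi>"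
  shows "\<exists>G. trace_form (I - \<Union>\<pi>) G \<and>
    (\<forall>n B d x. so_dual_bases n B d \<longrightarrow> x \<in> (I - \<Union>\<pi>) \<rightarrow> so n \<longrightarrow>
      contract B d \<pi> (F n) x = G n x)"
  using assms(2-)
proof (induction rule: finite_induct)
  case empty
  then show ?case using F by (auto simp: contract_def plug_def)
next
  case (insert P \<pi>)
  obtain G' where G': "trace_form (I - \<Union>\<pi>) G'"
    and eq': "\<And>n B d x. so_dual_bases n B d \<Longrightarrow> x \<in> (I - \<Union>\<pi>) \<rightarrow> so n \<Longrightarrow>
      contract B d \<pi> (F n) x = G' n x"
    using insert by (auto simp: pairwise_insert)
  obtain a b where P: "P = {a, b}" "a < b"
    using insert.prems(1) by (metis card_2_iff insertI1 insert_commute linorder_neqE_nat)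
  have PU: "P \<inter> \<Union>\<pi> = {}" using insert.prems(2) insert.hyps(2) by (auto simp: pairwise_insert disjnt_def)
  have ab: "a \<in> I - \<Union>\<pi>" "b \<in> I - \<Union>\<pi>" "a \<noteq> b" using insert.prems(1) P PU by auto
  have I: "I - \<Union>\<pi> - {a, b} = I - \<Union>(insert P \<pi>)" using P by auto
  obtain G where G: "trace_form (I - \<Union>(insert P \<pi>)) G"
    and eq: "\<And>n B d x. so_dual_bases n B d \<Longrightarrow> x \<in> (I - \<Union>(insert P \<pi>)) \<rightarrow> so n \<Longrightarrow>
      (\<Sum>\<alpha>\<in>B. G' n (x(a := \<alpha>, b := d \<alpha>))) = G n x"
    using contract_pair[OF G' ab] unfolding I by blast
  have "contract B d (insert P \<pi>) (F n) x = G n x"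
    if D: "so_dual_bases n B d" and x: "x \<in> (I - \<Union>(insert P \<pi>)) \<rightarrow> so n" for n B d x
    unfolding eq[OF D x, symmetric] contract_insert[OF insert.hyps(1) insert.prems(2) insert.hyps(2) P]
  proof (intro sum.cong refl eq'[OF D])
    fix \<alpha> assume "\<alpha> \<in> B"
    then show "x(a := \<alpha>, b := d \<alpha>) \<in> (I - \<Union>\<pi>) \<rightarrow> so n"
      using D x[folded I] so_basis_subset[of B n] by (auto simp: so_dual_bases_def Pi_iff)
  qed
  with G show ?case by blast
qed

section \<open>The trace of a product of adjoint operators\<close>

lemma ad_iterate_so:
  "x \<in> set is \<rightarrow> so n \<Longrightarrow> u \<in> so n \<Longrightarrow> foldr (\<lambda>i. ad (x i)) is u \<in> so n"
  by (induction "is") (auto intro!: so_ad)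

text \<open>Writing each \<open>ad (x i)\<close> as left minus right multiplication moves \<open>x i\<close> into the word on the left
  or the word on the right of the argument. The words \<open>u\<close> and \<open>v\<close> collect the letters moved so far;
  when all are moved, a single contraction within one trace is left.\<close>

lemma trace_form_ad_word:
  assumes "distinct (u @ is @ v)"
  shows "\<exists>G. trace_form (set (u @ is @ v)) G \<and>
    (\<forall>n B d x. so_dual_bases n B d \<longrightarrow> x \<in> set (u @ is @ v) \<rightarrow> so n \<longrightarrow>
      (\<Sum>b\<in>B. mat_trace (mat_prod n x u * foldr (\<lambda>i. ad (x i)) is b * mat_prod n x v * d b)) =
        (G n x :: 'a :: field_char_0))"
  using assms
proof (induction "is" arbitrary: u v)
  case Nil
  define G :: "nat \<Rightarrow> (nat \<Rightarrow> 'a mat) \<Rightarrow> 'a" where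
    "G = (\<lambda>n x. 1 / 2 * trace_monomial n x [u, v]
      + (- 1) ^ Suc (length v) / 2 * trace_monomial n x [u @ rev v])"
  have "trace_form (set (u @ [] @ v)) G"
    unfolding G_def
    by (rule trace_form_lincomb[OF trace_form_monomial trace_form_monomial]) (use Nil in auto)
  moreover have "(\<Sum>b\<in>B. mat_trace (mat_prod n x u * b * mat_prod n x v * d b)) = G n x"
    if D: "so_dual_bases n B d" and x: "x \<in> set (u @ v) \<rightarrow> so n" for n B d x
  proof -
    have xu: "x \<in> set u \<rightarrow> so n" and xv: "x \<in> set v \<rightarrow> so n" and xv': "x \<in> set (rev v) \<rightarrow> so n"
      using x by auto
    note c = mat_prod_carrier[OF xu] mat_prod_carrier[OF xv] mat_prod_carrier[OF xv']
    show ?thesis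
      using c xu xv
      by (simp add: contract_one_trace[OF D] transpose_mat_prod mult_smult_distrib[of _ n n _ n]
          mat_trace_smult[of _ n] mat_prod_append G_def field_simps Pi_iff ball_Un)
  qed
  ultimately show ?case by auto
next
  case (Cons i "is")
  let ?I = "set (u @ (i # is) @ v)"
  let ?L = "\<lambda>x :: nat \<Rightarrow> 'a mat. foldr (\<lambda>i. ad (x i)) is"
  have sets: "set ((u @ [i]) @ is @ v) = ?I" "set (u @ is @ (i # v)) = ?I" by auto
  obtain G1 where G1: "trace_form ?I G1"
    and eq1: "\<And>n B d x. so_dual_bases n B d \<Longrightarrow> x \<in> ?I \<rightarrow> so n \<Longrightarrow>
      (\<Sum>b\<in>B. mat_trace (mat_prod n x (u @ [i]) * ?L x b * mat_prod n x v * d b)) = (G1 n x :: 'a)"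
    using Cons.IH[of "u @ [i]" v] Cons.prems unfolding sets by auto
  obtain G2 where G2: "trace_form ?I G2"
    and eq2: "\<And>n B d x. so_dual_bases n B d \<Longrightarrow> x \<in> ?I \<rightarrow> so n \<Longrightarrow>
      (\<Sum>b\<in>B. mat_trace (mat_prod n x u * ?L x b * mat_prod n x (i # v) * d b)) = (G2 n x :: 'a)"
    using Cons.IH[of u "i # v"] Cons.prems unfolding sets by auto
  have "(\<Sum>b\<in>B. mat_trace (mat_prod n x u * foldr (\<lambda>i. ad (x i)) (i # is) b * mat_prod n x v * d b))
      = 1 * G1 n x + (- 1) * G2 n x"
    if D: "so_dual_bases n B d" and x: "x \<in> ?I \<rightarrow> so n" for n B d x
  proof -
    have "mat_trace (mat_prod n x u * foldr (\<lambda>i. ad (x i)) (i # is) b * mat_prod n x v * d b) =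
      mat_trace (mat_prod n x (u @ [i]) * ?L x b * mat_prod n x v * d b)
      - mat_trace (mat_prod n x u * ?L x b * mat_prod n x (i # v) * d b)" if b: "b \<in> B" for b
    proof -
      have bso: "b \<in> so n" "d b \<in> so n"
        using D b so_basis_subset[of B n] by (auto simp: so_dual_bases_def)
      have L: "?L x b \<in> carrier_mat n n"
        using x bso by (intro so_carrier[OF ad_iterate_so]) auto
      have c: "mat_prod n x u \<in> carrier_mat n n" "mat_prod n x v \<in> carrier_mat n n" "x i \<in> carrier_mat n n"
          "d b \<in> carrier_mat n n"
        using x bso by (auto intro: mat_prod_carrier so_carrier)
      have "mat_prod n x (u @ [i]) = mat_prod n x u * x i"
        using x c by (subst mat_prod_append) auto
      moreover have "mat_prod n x u * (x i * ?L x b - ?L x b * x i) * mat_prod n x v * d b =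
        mat_prod n x u * x i * ?L x b * mat_prod n x v * d b
        - mat_prod n x u * ?L x b * (x i * mat_prod n x v) * d b"
        using c L by (simp add: mult_minus_distrib_mat[of _ n n _ n] minus_mult_distrib_mat[of _ n n _ _ n]
            assoc_mult_mat[of _ n n _ n _ n])
      ultimately show ?thesis
        using c L by (simp add: ad_def, subst mat_trace_diff[of _ n]) (auto intro!: mult_carrier_mat[of _ n n])
    qed
    then show ?thesis
      by (simp add: sum_subtractf eq1[OF D x, symmetric] eq2[OF D x, symmetric] del: mat_prod_Cons foldr_Cons)
  qed
  with trace_form_lincomb[OF G1 G2, of 1 "- 1"] show ?case by blast
qed

lemma trace_form_ad_trace:
  "trace_form {1..k} (\<lambda>n (x :: nat \<Rightarrow> 'a :: field_char_0 mat). ad_trace n k x)"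
proof -
  have dis: "distinct ([] @ [1..<Suc k] @ [])" and I: "set ([] @ [1..<Suc k] @ []) = {1..k}"
    by auto
  obtain G where G: "trace_form {1..k} G"
    and eq: "\<And>n B d x. so_dual_bases n B d \<Longrightarrow> x \<in> {1..k} \<rightarrow> so n \<Longrightarrow>
      (\<Sum>b\<in>B. mat_trace (mat_prod n x [] * foldr (\<lambda>i. ad (x i)) [1..<Suc k] b * mat_prod n x [] * d b))
        = (G n x :: 'a)"
    using trace_form_ad_word[OF dis, where 'a='a] unfolding I by blast
  have "ad_trace n k x = G n x" if x: "x \<in> {1..k} \<rightarrow> so n" for n x
  proof -
    obtain B d where D: "so_dual_bases n B (d :: 'a mat \<Rightarrow> 'a mat)"
      and tr: "\<forall>L \<in> so n \<rightarrow> so n. operator_trace (so_space n) L = (\<Sum>b\<in>B. mat_trace (L b * d b))"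
      using operator_trace_so by blast
    let ?L = "foldr (\<lambda>i. ad (x i)) [1..<Suc k]"
    have L: "?L b \<in> so n" if "b \<in> so n" for b
      by (rule ad_iterate_so[OF _ that]) (use x in auto)
    have "ad_trace n k x = (\<Sum>b\<in>B. mat_trace (?L b * d b))"
      unfolding ad_trace_def using L by (intro tr[rule_format]) auto
    also have "\<dots> = G n x"
      unfolding eq[OF D x, symmetric]
    proof (rule sum.cong[OF refl])
      fix b assume "b \<in> B"
      then have "b \<in> so n" using D so_basis_subset[of B n] by (auto simp: so_dual_bases_def)
      then have "?L b \<in> carrier_mat n n" by (rule so_carrier[OF L])
      then show "mat_trace (?L b * d b) =
          mat_trace (mat_prod n x [] * ?L b * mat_prod n x [] * d b)"
        by (simp del: upt_Suc)
    qed
    finally show ?thesis .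
  qed
  then show ?thesis by (rule trace_form_cong[OF G])
qed

section \<open>From trace forms to trace expressions\<close>

text \<open>Empty words have trace \<open>n\<close>, so removing them multiplies the coefficient by a power of the
  polynomial variable.\<close>

lemma trace_form_expressions:
  assumes "trace_form I F"
  shows "\<exists>E p. finite E \<and> E \<subseteq> trace_exprs_over I \<and>
    (\<forall>n x. x \<in> I \<rightarrow> so n \<longrightarrow>
      F n x = (\<Sum>T\<in>E. poly (p T) (of_nat n :: 'a :: field_char_0) * expr_value n x T))"
  using assms
proof (induction rule: trace_form.induct)
  case (monomial T F p)
  let ?strip = "\<lambda>T. map (map Plain) (filter (\<lambda>w. w \<noteq> []) T)"
  let ?e = "length (filter (\<lambda>w. w = []) T)"
  have split: "trace_monomial n x S = of_nat n ^ length (filter (\<lambda>w. w = []) S) * expr_value n x (?strip S)"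
    for n S and x :: "nat \<Rightarrow> 'a mat"
    by (induction S) (auto simp: expr_value_def mat_prod_def[symmetric] mat_trace_def mult_ac)
  show ?case
    using monomial(2,3)
    by (intro exI[of _ "{?strip T}"] exI[of _ "\<lambda>_. p * monom 1 ?e"])
      (auto simp: trace_exprs_over_def split poly_monom image_image)
next
  case (add F G H)
  obtain E p where E: "finite E" "E \<subseteq> trace_exprs_over I"
    and F: "\<And>n x. x \<in> I \<rightarrow> so n \<Longrightarrow> F n x = (\<Sum>T\<in>E. poly (p T) (of_nat n) * expr_value n x T)"
    using add.IH(1) by blast
  obtain E' p' where E': "finite E'" "E' \<subseteq> trace_exprs_over I"
    and G: "\<And>n x. x \<in> I \<rightarrow> so n \<Longrightarrow> G n x = (\<Sum>T\<in>E'. poly (p' T) (of_nat n) * expr_value n x T)"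
    using add.IH(2) by blast
  let ?q = "\<lambda>T. (if T \<in> E then p T else 0) + (if T \<in> E' then p' T else 0)"
  have "H n x = (\<Sum>T\<in>E \<union> E'. poly (?q T) (of_nat n) * expr_value n x T)" if x: "x \<in> I \<rightarrow> so n" for n x
  proof -
    have "(\<Sum>T\<in>E. poly (p T) (of_nat n) * expr_value n x T) =
        (\<Sum>T\<in>E \<union> E'. poly (if T \<in> E then p T else 0) (of_nat n) * expr_value n x T)"
      using E E' by (intro sum.mono_neutral_cong_left) auto
    moreover have "(\<Sum>T\<in>E'. poly (p' T) (of_nat n) * expr_value n x T) =
        (\<Sum>T\<in>E \<union> E'. poly (if T \<in> E' then p' T else 0) (of_nat n) * expr_value n x T)"
      using E E' by (intro sum.mono_neutral_cong_left) auto
    ultimately show ?thesis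
      unfolding add.hyps(3)[OF x] F[OF x] G[OF x] by (simp add: sum.distrib distrib_right)
  qed
  then show ?case using E E' by (intro exI[of _ "E \<union> E'"] exI[of _ ?q]) auto
qed

theorem theorem3:
  fixes k :: nat and \<pi> :: "nat set set"
  assumes "\<forall>P\<in>\<pi>. P \<subseteq> {1..k} \<and> card P = 2"
    and "pairwise disjnt \<pi>"
  shows "\<exists>(E :: trace_expr set) (p :: trace_expr \<Rightarrow> 'a :: field_char_0 poly).
    finite E \<and> E \<subseteq> trace_exprs_over (free_indices k \<pi>) \<and>
    (\<forall>n\<ge>2. \<forall>B d. so_dual_bases n B d \<longrightarrow>
      (\<forall>x \<in> free_indices k \<pi> \<rightarrow> so n.
        contract B d \<pi> (ad_trace n k) x =
          (\<Sum>T\<in>E. poly (p T) (of_nat n) * expr_value n x T)))"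
proof -
  have "\<pi> \<subseteq> Pow {1..k}" using assms(1) by auto
  then have "finite \<pi>" by (rule finite_subset) simp
  from contract_trace_form[OF trace_form_ad_trace this assms, where 'a = 'a]
  obtain G where G: "trace_form (free_indices k \<pi>) G"
    and eq: "\<forall>n B d x. so_dual_bases n B d \<longrightarrow> x \<in> free_indices k \<pi> \<rightarrow> so n \<longrightarrow>
      contract B d \<pi> (ad_trace n k) x = (G n x :: 'a)"
    unfolding free_indices_def by (elim exE conjE)
  obtain E p where E: "finite E" "E \<subseteq> trace_exprs_over (free_indices k \<pi>)"
    and expr: "\<forall>n x. x \<in> free_indices k \<pi> \<rightarrow> so n \<longrightarrow>
      G n x = (\<Sum>T\<in>E. poly (p T) (of_nat n) * expr_value n x T)"
    using trace_form_expressions[OF G] by (elim exE conjE)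
  show ?thesis
    using E eq expr by (intro exI[of _ E] exI[of _ p]) simp
qed

end
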